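(* Let $\mathfrak L$ and $\mathfrak L'$ be languages with value domains $\mathbb V$ and $\mathbb V'$, let $\sim$ be an equivalence relation on a class $\mathbb Z\supseteq\mathbb V\cup\mathbb V'$, and let $\mathcal T:\mathbb T_{\mathfrak L}\to\mathbb T_{\mathfrak L'}$ be a translation from $\mathfrak L$ into $\mathfrak L'$ such that $\sim$ is a congruence for $\mathcal T(\mathfrak L)$. If $\mathcal T$ is valid up to $\sim$, then $\mathcal T$ is correct up to $\sim$.
   Context: Fix a set $\mathcal V$ of variables. A language $\mathfrak L$ consists of a set $\mathbb T_{\mathfrak L}$ of expressions built from variables in $\mathcal V$ by operators (and possibly variable-binding recursion constructs), a domain of values $\mathbb V$, and a semantic mapping $[\![\cdot]\!]_{\mathfrak L}:\mathbb T_{\mathfrak L}\to((\mathcal V\to\mathbb V)\to\mathbb V)$; a function $\rho:\mathcal V\to\mathbb V$ is a valuation. Substitutions $\sigma:\mathcal V\rightharpoonup\mathbb T_{\mathfrak L}$ (extended by $\sigma(Y)=Y$ outside the domain) act on terms by capture-avoiding replacement of free variables, written $E[\sigma]$; $\stackrel{\alpha}{=}$ is equality up to renaming of bound variables. The semantics satisfies $[\![E[\sigma]]\!]_{\mathfrak L}(\rho)=[\![E]\!]_{\mathfrak L}([\![\sigma]\!]_{\mathfrak L}(\rho))$, where $[\![\sigma]\!]_{\mathfrak L}(\rho)$ is the valuation $X\mapsto[\![\sigma(X)]\!]_{\mathfrak L}(\rho)$, and $\alpha$-equal terms have equal meaning. A closed expression is one with no free variables; its meaning $[\![P]\!]_{\mathfrak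 L}(\rho)$ does not depend on $\rho$ and is written $[\![P]\!]_{\mathfrak L}$; $\mathcal T_{\mathfrak L}$ denotes the set of closed expressions of $\mathfrak L$. Valuations $\eta,\rho:\mathcal V\to\mathbb Z$ are $\sim$-equivalent, $\eta\sim\rho$, if $\eta(X)\sim\rho(X)$ for all $X$. Let $\mathbb U:=\{v'\in\mathbb V'\mid\exists v\in\mathbb V.\ v'\sim v\}$. A translation $\mathcal T$ is correct up to $\sim$ if (i) for every $v\in\mathbb V$ there is $v'\in\mathbb V'$ with $v'\sim v$, and (ii) $[\![\mathcal T(E)]\!]_{\mathfrak L'}(\eta)\sim[\![E]\!]_{\mathfrak L}(\rho)$ for all $E\in\mathbb T_{\mathfrak L}$ and all valuations $\eta:\mathcal V\to\mathbb V'$, $\rho:\mathcal V\to\mathbb V$ with $\eta\sim\rho$. $\sim$ is a congruence for $\mathcal T(\mathfrak L)$ if $[\![\mathcal T(E)]\!]_{\mathfrak L'}(\nu)\sim[\![\mathcal T(E)]\!]_{\mathfrak L'}(\eta)$ for all $E\in\mathbb T_{\mathfrak L}$ and all $\nu,\eta:\mathcal V\to\mathbb U$ with $\nu\sim\eta$. $\mathcal T$ respects $\sim$ if (i) above holds and $[\![\mathcal T(P)]\!]_{\mathfrak L'}(\eta)\sim[\![P]\!]_{\mathfrak L}$ for all closed $P\in\mathcal T_{\mathfrak L}$ and all valuations $\eta:\mathcal V\to\mathbb U$. $\mathcal T$ is compositional if $\mathcal T(X)=X$ for all $X\in\mathcal V$ and $\mathcal T(E[\sigma])\stackrel{\alpha}{=}\mathcal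 T(E)[\mathcal T\circ\sigma]$ for all $E$ and substitutions $\sigma$. $\mathcal T$ is valid up to $\sim$ if it is compositional, respects $\sim$, and $\mathfrak L$ satisfies: for every $v\in\mathbb V$ there is a closed $P\in\mathcal T_{\mathfrak L}$ with $[\![P]\!]_{\mathfrak L}=v$. *)

theory Defs
  imports Main "HOL-Library.FuncSet"
begin

text \<open>
  Expressions over variables \<open>'x\<close>, operators \<open>'f\<close> and recursion constructs \<open>'r\<close>.
  \<open>Rec r xs Es\<close> binds all of \<open>xs\<close> in all of \<open>Es\<close>: the usual \<open>\<mu>X. E\<close> is \<open>Rec \<mu> [X] [E]\<close>, and the
  \<open>X\<^sub>k\<close>-component of the system of equations \<open>X\<^sub>1 = E\<^sub>1, \<dots>, X\<^sub>n = E\<^sub>n\<close> is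
  \<open>Rec k [X\<^sub>1, \<dots>, X\<^sub>n] [E\<^sub>1, \<dots>, E\<^sub>n]\<close>.  Arities are not fixed here; which expressions are valid
  is part of a language.
\<close>

datatype ('f, 'r, 'x) trm =
    Var 'x
  | App 'f "('f, 'r, 'x) trm list"
  | Rec 'r "'x list" "('f, 'r, 'x) trm list"

fun fv :: "('f, 'r, 'x) trm \<Rightarrow> 'x set" where
  "fv (Var x) = {x}"
| "fv (App f Es) = (\<Union>E\<in>set Es. fv E)"
| "fv (Rec r xs Es) = (\<Union>E\<in>set Es. fv E) - set xs"

text \<open>
  Bound variables are kept when no capture threatens, and otherwise renamed by some injective \<open>g\<close>
  into fresh ones.  If there are infinitely many variables, such a \<open>g\<close> always exists.
\<close>

definition binder_renaming :: "'x list \<Rightarrow> 'x set \<Rightarrow> 'x \<Rightarrow> 'x" where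
  "binder_renaming xs A =
    (if set xs \<inter> A = {} then id else SOME g. inj_on g (set xs) \<and> g ` set xs \<inter> A = {})"

fun subst_total :: "('f, 'r, 'x) trm \<Rightarrow> ('x \<Rightarrow> ('f, 'r, 'x) trm) \<Rightarrow> ('f, 'r, 'x) trm" where
  "subst_total (Var x) s = s x"
| "subst_total (App f Es) s = App f (map (\<lambda>E. subst_total E s) Es)"
| "subst_total (Rec r xs Es) s =
    (let g = binder_renaming xs (\<Union>y\<in>fv (Rec r xs Es). fv (s y));
         s' = (\<lambda>y. if y \<in> set xs then Var (g y) else s y)
     in Rec r (map g xs) (map (\<lambda>E. subst_total E s') Es))"

type_synonym ('f, 'r, 'x) substitution = "'x \<rightharpoonup> ('f, 'r, 'x) trm"

definition subst_fun :: "('f, 'r, 'x) substitution \<Rightarrow> 'x \<Rightarrow> ('f, 'r, 'x) trm" where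
  "subst_fun \<sigma> x = (case \<sigma> x of None \<Rightarrow> Var x | Some E \<Rightarrow> E)"

definition subst_trm :: "('f, 'r, 'x) trm \<Rightarrow> ('f, 'r, 'x) substitution \<Rightarrow> ('f, 'r, 'x) trm" where
  "subst_trm E \<sigma> = subst_total E (subst_fun \<sigma>)"

text \<open>
  Equality up to renaming of bound variables.  \<open>map_trm id id p\<close> applies \<open>p\<close> to all variables,
  including the binders; for a bijection \<open>p\<close> this is a renaming of the bound variables \<open>xs\<close> of
  \<open>Rec r xs Es\<close> provided that \<open>p\<close> fixes its free variables.
\<close>

inductive alpha_eq :: "('f, 'r, 'x) trm \<Rightarrow> ('f, 'r, 'x) trm \<Rightarrow> bool" where
  Var: "alpha_eq (Var x) (Var x)"
| App: "list_all2 alpha_eq Es Fs \<Longrightarrow> alpha_eq (App f Es) (App f Fs)"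
| Rec: "\<lbrakk>bij p; \<forall>x\<in>fv (Rec r xs Es). p x = x; list_all2 alpha_eq (map (map_trm id id p) Es) Fs\<rbrakk>
        \<Longrightarrow> alpha_eq (Rec r xs Es) (Rec r (map p xs) Fs)"

record ('f, 'r, 'x, 'z) lang =
  exprs :: "('f, 'r, 'x) trm set"
  vals :: "'z set"
  sem :: "('f, 'r, 'x) trm \<Rightarrow> ('x \<Rightarrow> 'z) \<Rightarrow> 'z"

definition valuations :: "'z set \<Rightarrow> ('x \<Rightarrow> 'z) set" where
  "valuations V = (UNIV \<rightarrow> V)"

definition substitutions :: "('f, 'r, 'x, 'z) lang \<Rightarrow> ('f, 'r, 'x) substitution set" where
  "substitutions L = {\<sigma>. ran \<sigma> \<subseteq> exprs L}"

definition sem_subst ::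
    "('f, 'r, 'x, 'z) lang \<Rightarrow> ('f, 'r, 'x) substitution \<Rightarrow> ('x \<Rightarrow> 'z) \<Rightarrow> 'x \<Rightarrow> 'z" where
  "sem_subst L \<sigma> \<rho> = (\<lambda>x. sem L (subst_fun \<sigma> x) \<rho>)"

definition closed_exprs :: "('f, 'r, 'x, 'z) lang \<Rightarrow> ('f, 'r, 'x) trm set" where
  "closed_exprs L = {P \<in> exprs L. fv P = {}}"

locale language =
  fixes L :: "('f, 'r, 'x, 'z) lang"
  assumes Var_in_exprs: "Var x \<in> exprs L"
    and subst_in_exprs: "\<lbrakk>E \<in> exprs L; \<sigma> \<in> substitutions L\<rbrakk> \<Longrightarrow> subst_trm E \<sigma> \<in> exprs L"
    and sem_in_vals: "\<lbrakk>E \<in> exprs L; \<rho> \<in> valuations (vals L)\<rbrakk> \<Longrightarrow> sem L E \<rho> \<in> vals L"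
    and sem_subst_trm: "\<lbrakk>E \<in> exprs L; \<sigma> \<in> substitutions L; \<rho> \<in> valuations (vals L)\<rbrakk>
      \<Longrightarrow> sem L (subst_trm E \<sigma>) \<rho> = sem L E (sem_subst L \<sigma> \<rho>)"
    and sem_alpha: "\<lbrakk>E \<in> exprs L; F \<in> exprs L; alpha_eq E F; \<rho> \<in> valuations (vals L)\<rbrakk>
      \<Longrightarrow> sem L E \<rho> = sem L F \<rho>"
    and sem_closed: "\<lbrakk>P \<in> closed_exprs L; \<rho> \<in> valuations (vals L); \<rho>' \<in> valuations (vals L)\<rbrakk>
      \<Longrightarrow> sem L P \<rho> = sem L P \<rho>'"

text \<open>By \<open>sem_closed\<close>, the choice of the valuation is immaterial.\<close>

definition closed_sem :: "('f, 'r, 'x, 'z) lang \<Rightarrow> ('f, 'r, 'x) trm \<Rightarrow> 'z" where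
  "closed_sem L P = sem L P (SOME \<rho>. \<rho> \<in> valuations (vals L))"

definition val_equiv :: "('z \<times> 'z) set \<Rightarrow> ('x \<Rightarrow> 'z) \<Rightarrow> ('x \<Rightarrow> 'z) \<Rightarrow> bool" where
  "val_equiv R \<eta> \<rho> \<longleftrightarrow> (\<forall>x. (\<eta> x, \<rho> x) \<in> R)"

text \<open>
  In the following, \<open>L\<close> is the source and \<open>L'\<close> the target language, and the equivalence relation
  \<open>\<sim>\<close> is the set of pairs \<open>R\<close>.
\<close>

definition is_translation ::
    "('f, 'r, 'x, 'z) lang \<Rightarrow> ('g, 's, 'x, 'z) lang
      \<Rightarrow> (('f, 'r, 'x) trm \<Rightarrow> ('g, 's, 'x) trm) \<Rightarrow> bool" where
  "is_translation L L' T \<longleftrightarrow> T \<in> exprs L \<rightarrow> exprs L'"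

definition equiv_vals ::
    "('f, 'r, 'x, 'z) lang \<Rightarrow> ('g, 's, 'x, 'z) lang \<Rightarrow> ('z \<times> 'z) set \<Rightarrow> 'z set" where
  "equiv_vals L L' R = {v' \<in> vals L'. \<exists>v\<in>vals L. (v', v) \<in> R}"

definition vals_covered ::
    "('f, 'r, 'x, 'z) lang \<Rightarrow> ('g, 's, 'x, 'z) lang \<Rightarrow> ('z \<times> 'z) set \<Rightarrow> bool" where
  "vals_covered L L' R \<longleftrightarrow> (\<forall>v\<in>vals L. \<exists>v'\<in>vals L'. (v', v) \<in> R)"

definition correct_upto ::
    "('f, 'r, 'x, 'z) lang \<Rightarrow> ('g, 's, 'x, 'z) lang \<Rightarrow> ('z \<times> 'z) set
      \<Rightarrow> (('f, 'r, 'x) trm \<Rightarrow> ('g, 's, 'x) trm) \<Rightarrow> bool" where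
  "correct_upto L L' R T \<longleftrightarrow>
    vals_covered L L' R \<and>
    (\<forall>E\<in>exprs L. \<forall>\<eta>\<in>valuations (vals L'). \<forall>\<rho>\<in>valuations (vals L).
      val_equiv R \<eta> \<rho> \<longrightarrow> (sem L' (T E) \<eta>, sem L E \<rho>) \<in> R)"

definition congruence_for ::
    "('f, 'r, 'x, 'z) lang \<Rightarrow> ('g, 's, 'x, 'z) lang \<Rightarrow> ('z \<times> 'z) set
      \<Rightarrow> (('f, 'r, 'x) trm \<Rightarrow> ('g, 's, 'x) trm) \<Rightarrow> bool" where
  "congruence_for L L' R T \<longleftrightarrow>
    (\<forall>E\<in>exprs L. \<forall>\<nu>\<in>valuations (equiv_vals L L' R). \<forall>\<eta>\<in>valuations (equiv_vals L L' R).
      val_equiv R \<nu> \<eta> \<longrightarrow> (sem L' (T E) \<nu>, sem L' (T E) \<eta>) \<in> R)"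

definition respects_equiv ::
    "('f, 'r, 'x, 'z) lang \<Rightarrow> ('g, 's, 'x, 'z) lang \<Rightarrow> ('z \<times> 'z) set
      \<Rightarrow> (('f, 'r, 'x) trm \<Rightarrow> ('g, 's, 'x) trm) \<Rightarrow> bool" where
  "respects_equiv L L' R T \<longleftrightarrow>
    vals_covered L L' R \<and>
    (\<forall>P\<in>closed_exprs L. \<forall>\<eta>\<in>valuations (equiv_vals L L' R).
      (sem L' (T P) \<eta>, closed_sem L P) \<in> R)"

text \<open>\<open>map_option T \<circ> \<sigma>\<close> is the partial function \<open>T \<circ> \<sigma>\<close>, with the same domain as \<open>\<sigma>\<close>.\<close>

definition compositional ::
    "('f, 'r, 'x, 'z) lang \<Rightarrow> (('f, 'r, 'x) trm \<Rightarrow> ('g, 's, 'x) trm) \<Rightarrow> bool" where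
  "compositional L T \<longleftrightarrow>
    (\<forall>x. T (Var x) = Var x) \<and>
    (\<forall>E\<in>exprs L. \<forall>\<sigma>\<in>substitutions L.
      alpha_eq (T (subst_trm E \<sigma>)) (subst_trm (T E) (map_option T \<circ> \<sigma>)))"

definition valid_upto ::
    "('f, 'r, 'x, 'z) lang \<Rightarrow> ('g, 's, 'x, 'z) lang \<Rightarrow> ('z \<times> 'z) set
      \<Rightarrow> (('f, 'r, 'x) trm \<Rightarrow> ('g, 's, 'x) trm) \<Rightarrow> bool" where
  "valid_upto L L' R T \<longleftrightarrow>
    compositional L T \<and> respects_equiv L L' R T \<and>
    (\<forall>v\<in>vals L. \<exists>P\<in>closed_exprs L. closed_sem L P = v)"

end

theory Submission
  imports Defs
begin

text \<open>
  Every value is denoted by a closed expression, so a valuation \<open>\<rho>\<close> of \<open>L\<close> is induced by a closed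
  substitution \<open>\<sigma>\<close>, and the meaning of \<open>E\<close> under \<open>\<rho>\<close> is that of the closed expression \<open>E[\<sigma>]\<close>.
  The translation respects \<open>\<sim>\<close> on \<open>E[\<sigma>]\<close>; by compositionality, the meaning of its translation is
  that of \<open>T E\<close> under the valuation induced by \<open>T \<circ> \<sigma>\<close>. This valuation is equivalent to \<open>\<rho>\<close>, hence
  to every \<open>\<eta> \<sim> \<rho>\<close>, and the congruence property replaces it by \<open>\<eta>\<close>.
\<close>

text \<open>
  The condition on \<open>s\<close> rules out capture, so that no bound variable is renamed and the choice in
  \<open>binder_renaming\<close>, which may be void over finitely many variables, is never made.
\<close>

lemma fv_subst_total_subset:
  assumes "\<And>y. fv (s y) \<subseteq> {y}"
  shows "fv (subst_total E s) \<subseteq> (\<Union>y\<in>fv E. fv (s y))"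
  using assms
proof (induction E arbitrary: s)
  case (Var x)
  then show ?case by simp
next
  case (App f Es)
  show ?case
    using App.IH[OF _ App.prems] by fastforce
next
  case (Rec r xs Es)
  define s' where "s' = (\<lambda>y. if y \<in> set xs then Var y else s y)"
  \<comment> \<open>Each \<open>y\<close> here is free in the recursion, hence not in
    \<open>xs\<close>, and \<open>s y\<close> has at most \<open>y\<close> free.\<close>
  have "set xs \<inter> (\<Union>y\<in>fv (Rec r xs Es). fv (s y)) = {}"
    using Rec.prems by fastforce
  then have "binder_renaming xs (\<Union>y\<in>fv (Rec r xs Es). fv (s y)) = id"
    by (simp add: binder_renaming_def)
  then have subst: "subst_total (Rec r xs Es) s = Rec r xs (map (\<lambda>E. subst_total E s') Es)"
    by (simp add: s'_def Let_def cong: if_cong)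
  have "fv (s' y) \<subseteq> {y}" for y
    using Rec.prems by (simp add: s'_def)
  then have IH: "fv (subst_total E s') \<subseteq> (\<Union>y\<in>fv E. fv (s' y))" if "E \<in> set Es" for E
    using Rec.IH that by blast
  show ?case
  proof
    fix z
    assume "z \<in> fv (subst_total (Rec r xs Es) s)"
    then obtain E where E: "E \<in> set Es" "z \<in> fv (subst_total E s')" and z: "z \<notin> set xs"
      by (auto simp: subst simp del: subst_total.simps)
    then obtain y where y: "y \<in> fv E" "z \<in> fv (s' y)"
      using IH by blast
    \<comment> \<open>For \<open>y\<close> in \<open>xs\<close>, \<open>s' y\<close> is
      \<open>Var y\<close>, which would put \<open>z = y\<close> in \<open>xs\<close>.\<close>
    with z have "y \<notin> set xs" "z \<in> fv (s y)"
      by (auto simp: s'_def split: if_splits)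
    with E y show "z \<in> (\<Union>y\<in>fv (Rec r xs Es). fv (s y))"
      by auto
  qed
qed

text \<open>As \<open>P\<close> is total with closed values, the bound on free variables is a union
  of empty sets.\<close>

lemma (in language) subst_in_closed_exprs:
  assumes "E \<in> exprs L" and "\<And>x. P x \<in> closed_exprs L"
  shows "subst_trm E (\<lambda>x. Some (P x)) \<in> closed_exprs L"
proof -
  have "(\<lambda>x. Some (P x)) \<in> substitutions L"
    using assms(2) by (auto simp: substitutions_def closed_exprs_def ran_def)
  moreover have "fv (subst_total E P) = {}"
    using fv_subst_total_subset[of P E] assms(2) by (auto simp: closed_exprs_def)
  moreover have "subst_fun (\<lambda>x. Some (P x)) = P"
    by (simp add: fun_eq_iff subst_fun_def)
  ultimately show ?thesis
    using subst_in_exprs[OF assms(1)] by (metis (mono_tags, lifting) closed_exprs_def mem_Collect_eq subst_trm_def)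
qed

text \<open>The given \<open>\<rho>\<close> shows that valuations exist, so the choice in
  \<open>closed_sem\<close> picks a genuine one.\<close>

lemma (in language) closed_sem_eq:
  assumes "P \<in> closed_exprs L" and "\<rho> \<in> valuations (vals L)"
  shows "closed_sem L P = sem L P \<rho>"
  unfolding closed_sem_def using assms by (metis sem_closed someI_ex)

theorem theorem4:
  fixes L :: "('f, 'r, 'x, 'z) lang"
    and L' :: "('g, 's, 'x, 'z) lang"
    and Z :: "'z set"
    and R :: "('z \<times> 'z) set"
    and T :: "('f, 'r, 'x) trm \<Rightarrow> ('g, 's, 'x) trm"
  assumes "language L" and "language L'"
    and "vals L \<union> vals L' \<subseteq> Z" and "equiv Z R"
    and "is_translation L L' T"
    and "congruence_for L L' R T"
    and "valid_upto L L' R T"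
  shows "correct_upto L L' R T"
proof -
  interpret L: language L by fact
  interpret L': language L' by fact
  have sym: "(a, b) \<in> R \<Longrightarrow> (b, a) \<in> R" for a b
    using \<open>equiv Z R\<close> by (auto elim: equivE dest: symD)
  have trans: "(a, b) \<in> R \<Longrightarrow> (b, c) \<in> R \<Longrightarrow> (a, c) \<in> R" for a b c
    using \<open>equiv Z R\<close> by (auto elim!: equivE dest: transD)
  have T: "E \<in> exprs L \<Longrightarrow> T E \<in> exprs L'" for E
    using \<open>is_translation L L' T\<close> by (auto simp: is_translation_def)
  have comp: "compositional L T" and resp: "respects_equiv L L' R T"
    and denot: "\<forall>v\<in>vals L. \<exists>P\<in>closed_exprs L. closed_sem L P = v"
    using \<open>valid_upto L L' R T\<close> by (auto simp: valid_upto_def)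
  have "(sem L' (T E) \<eta>, sem L E \<rho>) \<in> R"
    if E: "E \<in> exprs L" and \<eta>: "\<eta> \<in> valuations (vals L')" and \<rho>: "\<rho> \<in> valuations (vals L)"
      and equiv: "val_equiv R \<eta> \<rho>" for E \<eta> \<rho>
  proof -
    \<comment> \<open>Congruence and respect speak only of valuations into
      \<open>equiv_vals L L' R\<close>; here \<open>\<rho> x\<close> is the source value equivalent
      to \<open>\<eta> x\<close>.\<close>
    have \<eta>U: "\<eta> \<in> valuations (equiv_vals L L' R)"
      using \<eta> \<rho> equiv by (fastforce simp: valuations_def equiv_vals_def val_equiv_def)
    have "\<forall>x. \<exists>P. P \<in> closed_exprs L \<and> closed_sem L P = \<rho> x"
      using denot \<rho> by (auto simp: valuations_def Pi_iff)
    then obtain P where P: "\<And>x. P x \<in> closed_exprs L" and semP: "\<And>x. closed_sem L (P x) = \<rho> x"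
      by metis
    define \<sigma> where "\<sigma> = (\<lambda>x. Some (P x))"
    have Pe: "P x \<in> exprs L" for x
      using P by (simp add: closed_exprs_def)
    have \<sigma>: "\<sigma> \<in> substitutions L"
      using Pe by (auto simp: substitutions_def \<sigma>_def ran_def)
    have T\<sigma>: "map_option T \<circ> \<sigma> \<in> substitutions L'"
      using Pe T by (auto simp: substitutions_def \<sigma>_def ran_def)
    have closed: "subst_trm E \<sigma> \<in> closed_exprs L"
      unfolding \<sigma>_def using E P by (rule L.subst_in_closed_exprs)
    then have E\<sigma>: "subst_trm E \<sigma> \<in> exprs L"
      by (simp add: closed_exprs_def)
    have "sem L (P x) \<rho> = \<rho> x" for x
      using L.closed_sem_eq[OF P \<rho>] semP by metis
    then have "sem_subst L \<sigma> \<rho> = \<rho>"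
      by (simp add: sem_subst_def subst_fun_def \<sigma>_def)
    then have semE: "closed_sem L (subst_trm E \<sigma>) = sem L E \<rho>"
      using L.closed_sem_eq[OF closed \<rho>] L.sem_subst_trm[OF E \<sigma> \<rho>] by simp
    \<comment> \<open>The terms \<open>T (P x)\<close> are not known to be closed, so their meanings
      are taken at \<open>\<eta>\<close>.\<close>
    define \<nu> where "\<nu> = sem_subst L' (map_option T \<circ> \<sigma>) \<eta>"
    have \<nu>_eq: "\<nu> x = sem L' (T (P x)) \<eta>" for x
      by (simp add: \<nu>_def sem_subst_def subst_fun_def \<sigma>_def)
    \<comment> \<open>This is respect for \<open>\<sim>\<close> at the closed expression
      \<open>P x\<close>, which denotes \<open>\<rho> x\<close>.\<close>
    have \<nu>\<rho>: "(\<nu> x, \<rho> x) \<in> R" for x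
      using resp P \<eta>U semP unfolding respects_equiv_def \<nu>_eq by metis
    moreover have "\<nu> x \<in> vals L'" for x
      unfolding \<nu>_eq by (intro L'.sem_in_vals T Pe \<eta>)
    ultimately have \<nu>U: "\<nu> \<in> valuations (equiv_vals L L' R)"
      using \<rho> by (fastforce simp: valuations_def equiv_vals_def)
    have "val_equiv R \<eta> \<nu>"
      using \<nu>\<rho> equiv sym trans unfolding val_equiv_def by blast
    then have "(sem L' (T E) \<eta>, sem L' (T E) \<nu>) \<in> R"
      using \<open>congruence_for L L' R T\<close> E \<eta>U \<nu>U by (simp add: congruence_for_def)
    moreover have "sem L' (T E) \<nu> = sem L' (T (subst_trm E \<sigma>)) \<eta>"
    proof -
      have "alpha_eq (T (subst_trm E \<sigma>)) (subst_trm (T E) (map_option T \<circ> \<sigma>))"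
        using comp E \<sigma> by (simp add: compositional_def)
      then have "sem L' (T (subst_trm E \<sigma>)) \<eta> = sem L' (subst_trm (T E) (map_option T \<circ> \<sigma>)) \<eta>"
        using L'.sem_alpha L'.subst_in_exprs T E E\<sigma> T\<sigma> \<eta> by blast
      then show ?thesis
        using L'.sem_subst_trm[OF T[OF E] T\<sigma> \<eta>] by (simp add: \<nu>_def)
    qed
    moreover have "(sem L' (T (subst_trm E \<sigma>)) \<eta>, sem L E \<rho>) \<in> R"
      using resp closed \<eta>U semE unfolding respects_equiv_def by metis
    ultimately show ?thesis
      using trans by metis
  qed
  then show ?thesis
    using resp by (simp add: correct_upto_def respects_equiv_def)
qed

end
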